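(* Let $\mathbb{X}\subset\mathbb{R}^{d}$ be a nonempty closed subset with reach $\tau\in(0,\infty)$, and let $\mathcal{X}\subset\mathbb{R}^{d}$ be a set of points. Let $\{r_x>0: x\in\mathcal{X}\}$ be a set of radii indexed by $\mathcal{X}$. If $r_x\le\sqrt{\tau^{2}+(\tau-d_{\mathbb{X}}(x))^{2}}$ for all $x\in\mathcal{X}$, then for every nonempty $I\subset\mathcal{X}$ such that the intersection of restricted balls $\bigcap_{x\in I}\mathbb{B}_{\mathbb{X}}(x,r_x)$ is nonempty, this intersection is contractible.
   Context: $\|\cdot\|$ is the Euclidean norm and $d_{\mathbb{X}}(x)=\inf_{y\in\mathbb{X}}\|x-y\|$. For $x\in\mathbb{R}^d$ and $r>0$, $\mathbb{B}_{\mathbb{X}}(x,r)=\{y\in\mathbb{X}:\|x-y\|<r\}$ is the open restricted ball (its center need not lie in $\mathbb{X}$), with the subspace topology. For a closed set $\mathbb{X}$, the medial axis is $\mathrm{Med}(\mathbb{X})=\{x\in\mathbb{R}^d\setminus\mathbb{X}: \exists\, q_1\ne q_2\in\mathbb{X},\ \|q_1-x\|=\|q_2-x\|=d_{\mathbb{X}}(x)\}$, and the reach of $\mathbb{X}$ is $\tau_{\mathbb{X}}=\inf\{\|q-x\|: q\in\mathbb{X},\ x\in\mathrm{Med}(\mathbb{X})\}$. A space is contractible if it is homotopy equivalent to a point. *)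

theory Defs
  imports "HOL-Analysis.Analysis"
begin

definition restricted_ball :: "'a::metric_space set \<Rightarrow> 'a \<Rightarrow> real \<Rightarrow> 'a set" where
  "restricted_ball X x r = {y \<in> X. dist x y < r}"

definition medial_axis :: "'a::metric_space set \<Rightarrow> 'a set" where
  "medial_axis X =
     {x. x \<notin> X \<and> (\<exists>q1\<in>X. \<exists>q2\<in>X. q1 \<noteq> q2 \<and> dist q1 x = infdist x X \<and> dist q2 x = infdist x X)}"

(* Extended-real valued, so that the reach is infinite when the medial axis is empty
   (in particular when X is convex). *)
definition reach :: "'a::metric_space set \<Rightarrow> ereal" where
  "reach X = Inf {ereal (dist q x) | q x. q \<in> X \<and> x \<in> medial_axis X}"

end

theory Submission
  imports Defs
begin

text \<open>
  Fix a base point \<open>p\<close> of the intersection \<open>A\<close>. The straight-line homotopy to \<open>p\<close> leaves \<open>X\<close>, but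
  it stays at distance less than \<open>\<tau>\<close> from \<open>X\<close>, where the nearest-point projection is well defined
  and continuous, and projecting it back to \<open>X\<close> keeps it inside every ball. The latter rests on
  Federer's inequality: if \<open>m\<close> is the projection of \<open>z\<close>, then \<open>X\<close> misses the open ball of radius
  \<open>\<tau>\<close> tangent at \<open>m\<close> in direction \<open>z - m\<close>. That inequality in turn says that a normal segment can
  be prolonged up to length \<open>\<tau>\<close>; a prolongation by \<open>e\<close> from \<open>w\<close> is a fixed point of
  \<open>y \<mapsto> w + e n(y)\<close>, where \<open>n\<close> is the unit normal field, and it exists by Brouwer's theorem.
\<close>

section \<open>Closest points and norm identities\<close>

lemma infdist_eq_dist_closest_point:
  fixes S :: "'a::euclidean_space set"
  assumes "closed S" "S \<noteq> {}"
  shows "infdist x S = dist x (closest_point S x)"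
  using setdist_closest_point[OF assms] by (simp add: infdist_eq_setdist)

text \<open>This is Stewart's theorem. Its last term measures how far a segment bends inward, and is
  later traded against the distance to \<open>X\<close>.\<close>

lemma norm_convex_combination_power2:
  fixes p q m :: "'a::real_inner"
  shows "(norm ((1 - t) *\<^sub>R p + t *\<^sub>R q - m))\<^sup>2 =
    (1 - t) * (norm (p - m))\<^sup>2 + t * (norm (q - m))\<^sup>2 - t * (1 - t) * (norm (p - q))\<^sup>2"
  unfolding power2_norm_eq_inner
  by (simp add: inner_diff_left inner_diff_right inner_add_left inner_add_right inner_commute
      algebra_simps)

lemma norm_diff_scaleR_power2:
  fixes a b :: "'a::real_inner"
  shows "(norm (a - k *\<^sub>R b))\<^sup>2 = (norm a)\<^sup>2 - 2 * k * (a \<bullet> b) + k\<^sup>2 * (norm b)\<^sup>2"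
  unfolding power2_norm_eq_inner
  by (simp add: inner_diff_left inner_diff_right inner_commute power2_eq_square algebra_simps)

section \<open>The nearest-point projection inside the reach\<close>

locale reach_at_least =
  fixes X :: "'a::euclidean_space set" and \<tau> :: real
  assumes closed: "closed X" and nonempty: "X \<noteq> {}"
    and le_reach: "ereal \<tau> \<le> reach X"
begin

abbreviation proj where "proj \<equiv> closest_point X"

lemma proj_in: "proj z \<in> X"
  using closed nonempty by (rule closest_point_in_set)

lemma infdist_eq: "infdist z X = dist z (proj z)"
  using closed nonempty by (rule infdist_eq_dist_closest_point)

text \<open>A second nearest point would put \<open>z\<close> on the medial axis at distance less
  than \<open>\<tau>\<close> from \<open>X\<close>.\<close>

lemma proj_unique:
  assumes "infdist z X < \<tau>" "q \<in> X" "dist z q = infdist z X"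
  shows "q = proj z"
proof (rule ccontr)
  assume ne: "q \<noteq> proj z"
  have "z \<notin> X"
    using ne assms(2,3) closed closest_point_self by force
  then have "z \<in> medial_axis X"
    using ne assms(2,3) proj_in[of z] infdist_eq[of z]
    by (force simp: medial_axis_def dist_commute)
  then have "reach X \<le> ereal (dist q z)"
    using \<open>q \<in> X\<close> unfolding reach_def by (intro Inf_lower) auto
  then have "\<tau> \<le> dist q z"
    using le_reach order_trans by fastforce
  with assms show False by (simp add: dist_commute)
qed

lemma continuous_on_proj: "continuous_on {z. infdist z X < \<tau>} proj"
proof (clarsimp simp: continuous_on_iff)
  fix z and e :: real
  assume z: "infdist z X < \<tau>" and "0 < e"
  \<comment> \<open>Uniqueness makes \<open>Y\<close> strictly farther from \<open>z\<close> than
    \<open>X\<close> is. Moving \<open>z\<close> by less than half this gap cannot bring the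
    projection into \<open>Y\<close>.\<close>
  define Y where "Y = X - ball (proj z) e"
  show "\<exists>d>0. \<forall>y. infdist y X < \<tau> \<longrightarrow> dist y z < d \<longrightarrow> dist (proj y) (proj z) < e"
  proof (cases "Y = {}")
    case True
    then have "dist (proj y) (proj z) < e" for y
      using proj_in[of y] by (auto simp: Y_def dist_commute)
    then show ?thesis by (intro exI[of _ 1]) auto
  next
    case False
    have "closed Y" unfolding Y_def using closed by blast
    then obtain q where q: "q \<in> Y" "infdist z Y = dist z q"
      using False infdist_attains_inf by metis
    have "q \<in> X" "q \<noteq> proj z" using q(1) \<open>0 < e\<close> by (auto simp: Y_def)
    then have gap: "infdist z X < infdist z Y"
      using proj_unique[OF z] infdist_le[of q X z] q(2) by force
    show ?thesis
    proof (intro exI[of _ "(infdist z Y - infdist z X) / 2"] conjI allI impI)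
      show "0 < (infdist z Y - infdist z X) / 2" using gap by simp
      fix y assume y: "dist y z < (infdist z Y - infdist z X) / 2"
      have "dist z (proj y) \<le> infdist z X + 2 * dist y z"
        using dist_triangle[of z "proj y" y] infdist_eq[of y] infdist_triangle[of y X z]
        by (simp add: dist_commute)
      then have "proj y \<notin> Y"
        using y infdist_le[of "proj y" Y z] by fastforce
      then show "dist (proj y) (proj z) < e"
        using proj_in[of y] by (auto simp: Y_def dist_commute)
    qed
  qed
qed

section \<open>Prolonging normal segments, and Federer's inequality\<close>

lemma normal_extension_step:
  assumes "0 < e" "2 * e \<le> infdist w X" "infdist w X + e < \<tau>"
  shows "infdist (w + (e / infdist w X) *\<^sub>R (w - proj w)) X = infdist w X + e"
proof -
  define n where "n y = (1 / norm (y - proj y)) *\<^sub>R (y - proj y)" for y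
  \<comment> \<open>The bound \<open>2 * e \<le> infdist w X\<close> keeps the ball off
    \<open>X\<close>, so \<open>n\<close> is a unit vector there; the other bound keeps it where
    \<open>proj\<close> is continuous.\<close>
  have near: "infdist w X - e \<le> infdist y X" "infdist y X < \<tau>" if "y \<in> cball w e" for y
    using that assms infdist_triangle[of w X y] infdist_triangle[of y X w]
    by (auto simp: dist_commute)
  have off: "norm (y - proj y) > 0" if "y \<in> cball w e" for y
    using near(1)[OF that] assms(1,2) infdist_eq[of y] unfolding dist_norm by linarith
  have contp: "continuous_on (cball w e) proj"
    using near by (intro continuous_on_subset[OF continuous_on_proj]) blast
  have "continuous_on (cball w e) (\<lambda>y. w + e *\<^sub>R n y)"
    unfolding n_def using off by (intro continuous_intros contp) force
  moreover have norm_n: "norm (n y) = 1" if "y \<in> cball w e" for y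
    using off[OF that] by (simp add: n_def)
  then have "(\<lambda>y. w + e *\<^sub>R n y) \<in> cball w e \<rightarrow> cball w e"
    using \<open>0 < e\<close> by (simp add: dist_norm)
  ultimately obtain y where y: "y \<in> cball w e" "w + e *\<^sub>R n y = y"
    using brouwer_ball[OF \<open>0 < e\<close>] by metis
  define s where "s = norm (y - proj y)"
  have s: "infdist y X = s" by (simp add: s_def infdist_eq dist_norm)
  have ny: "y - proj y = s *\<^sub>R n y" using off[OF y(1)] by (simp add: n_def s_def)
  \<comment> \<open>The fixed point equation places \<open>w\<close> on the segment from
    \<open>y\<close> to \<open>proj y\<close>. Two triangle estimates then force
    \<open>infdist w X = s - e\<close>, so \<open>w\<close> and \<open>y\<close> share their
    projection.\<close>
  have "w - proj y = (y - proj y) - e *\<^sub>R n y" using y(2) by (simp add: algebra_simps)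
  then have wy: "w - proj y = (s - e) *\<^sub>R n y" by (simp add: ny algebra_simps)
  have "e \<le> s" using near(1)[OF y(1)] s assms(2) by linarith
  then have d: "dist w (proj y) = s - e" using wy norm_n[OF y(1)] by (simp add: dist_norm)
  have "infdist w X \<le> s - e" using infdist_le[OF proj_in[of y], of w] d by simp
  moreover have "s \<le> infdist w X + e"
    using infdist_triangle[of y X w] y(1) s by (simp add: dist_commute)
  ultimately have s_eq: "infdist w X = s - e" by simp
  then have "proj y = proj w" using d assms(1,3) by (intro proj_unique proj_in) auto
  with wy have "(e / infdist w X) *\<^sub>R (w - proj w) = e *\<^sub>R n y"
    using s_eq assms(1,2) by simp
  then show ?thesis using y(2) s s_eq by simp
qed

text \<open>The lengths at which the normal ray realizes the distance to \<open>X\<close> form a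
  closed set. Its largest element up to \<open>t\<close> must be \<open>t\<close>, since otherwise
  \<open>normal_extension_step\<close> gives a larger one.\<close>

lemma infdist_along_normal:
  assumes "infdist z X = s" "0 < s" "s \<le> t" "t < \<tau>"
  shows "infdist (proj z + (t / s) *\<^sub>R (z - proj z)) X = t"
proof -
  define m where "m = proj z"
  define g where "g t' = m + (t' / s) *\<^sub>R (z - m)" for t'
  define T where "T = {t'. infdist (g t') X = t'} \<inter> {s..t}"
  have "closed {t'. infdist (g t') X = t'}"
    unfolding g_def using \<open>0 < s\<close> by (intro closed_Collect_eq continuous_intros) auto
  then have "compact T" unfolding T_def by (rule closed_Int_compact) simp
  moreover have "s \<in> T" using assms by (simp add: T_def g_def)
  ultimately obtain t' where t': "t' \<in> T" and max: "\<And>v. v \<in> T \<Longrightarrow> v \<le> t'"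
    using compact_attains_sup[of T] by blast
  have "t' = t"
  proof (rule ccontr)
    assume "t' \<noteq> t"
    with t' have b: "infdist (g t') X = t'" "s \<le> t'" "t' < t" by (auto simp: T_def)
    have gm: "g t' - m = (t' / s) *\<^sub>R (z - m)" by (simp add: g_def)
    have "norm (z - m) = s" using assms(1) infdist_eq[of z] by (simp add: m_def dist_norm)
    then have "dist (g t') m = t'" using gm b assms(2) by (simp add: dist_norm)
    then have m: "m = proj (g t')"
      using b assms by (intro proj_unique) (auto simp: m_def proj_in)
    define e where "e = min (t' / 2) (t - t')"
    have e: "0 < e" "2 * e \<le> t'" "t' + e \<le> t" using b assms(2) by (auto simp: e_def min_def)
    have "g t' + (e / t') *\<^sub>R (g t' - m) = g (t' + e)"
      unfolding gm using b assms by (simp add: g_def add_divide_distrib algebra_simps)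
    then have "infdist (g (t' + e)) X = t' + e"
      using normal_extension_step[of e "g t'"] e b assms m by auto
    then have "t' + e \<in> T" using e b by (simp add: T_def)
    then show False using max e by force
  qed
  then show ?thesis using t' by (simp add: T_def g_def m_def)
qed

text \<open>For \<open>t < \<tau>\<close> the prolonged point is at distance \<open>t\<close> from
  \<open>X\<close>, so \<open>q\<close> is outside the open ball of radius \<open>t\<close> around
  it. Expanding the square and letting \<open>t\<close> tend to \<open>\<tau>\<close> gives the
  claim.\<close>

lemma federer_inequality:
  assumes "infdist z X < \<tau>" "q \<in> X"
  shows "2 * \<tau> * ((q - proj z) \<bullet> (z - proj z)) \<le> norm (z - proj z) * (norm (q - proj z))\<^sup>2"
proof (cases "z = proj z")
  case True
  then show ?thesis by simp
next
  case False
  define m where "m = proj z"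
  define s where "s = norm (z - m)"
  define a where "a = (q - m) \<bullet> (z - m)"
  define b where "b = s * (norm (q - m))\<^sup>2"
  have s: "infdist z X = s" "0 < s" using False by (auto simp: s_def m_def infdist_eq dist_norm)
  have upto: "2 * t * a \<le> b" if "s \<le> t" "t < \<tau>" for t
  proof -
    have "t \<le> norm (q - m - (t / s) *\<^sub>R (z - m))"
      using infdist_along_normal[OF s that] infdist_le[OF assms(2), of "m + (t / s) *\<^sub>R (z - m)"]
      by (simp add: m_def dist_norm norm_minus_commute algebra_simps)
    then have "t\<^sup>2 \<le> (norm (q - m - (t / s) *\<^sub>R (z - m)))\<^sup>2"
      using that s by (intro power_mono) auto
    also have "\<dots> = (norm (q - m))\<^sup>2 - 2 * (t / s) * a + (t / s)\<^sup>2 * s\<^sup>2"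
      unfolding s_def a_def by (rule norm_diff_scaleR_power2)
    also have "(t / s)\<^sup>2 * s\<^sup>2 = t\<^sup>2" using s by (simp add: power_divide)
    finally show ?thesis using s by (simp add: b_def field_simps)
  qed
  have "2 * \<tau> * a \<le> b"
  proof (rule tendsto_upperbound)
    show "((\<lambda>t. 2 * t * a) \<longlongrightarrow> 2 * \<tau> * a) (at_left \<tau>)" by (intro tendsto_intros)
    show "\<forall>\<^sub>F t in at_left \<tau>. 2 * t * a \<le> b"
      using eventually_at_left_real[of s \<tau>] assms(1) s(1) upto by (auto elim!: eventually_mono)
  qed simp
  then show ?thesis by (simp add: a_def b_def m_def s_def)
qed

section \<open>Segments between two points of a restricted ball\<close>

lemma infdist_less_of_mem_ball:
  assumes "0 < \<tau>" "r \<le> sqrt (\<tau>\<^sup>2 + (\<tau> - infdist x X)\<^sup>2)" "p \<in> X" "dist x p < r"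
  shows "infdist x X < \<tau>" "r\<^sup>2 \<le> \<tau>\<^sup>2 + (\<tau> - infdist x X)\<^sup>2"
proof -
  have r: "infdist x X < r" "0 \<le> r"
    using infdist_le[OF assms(3), of x] assms(4) zero_le_dist[of x p] by linarith+
  show r2: "r\<^sup>2 \<le> \<tau>\<^sup>2 + (\<tau> - infdist x X)\<^sup>2"
    using power_mono[OF assms(2) r(2), of 2] by simp
  have "(infdist x X)\<^sup>2 < r\<^sup>2"
    using r infdist_nonneg by (intro power_strict_mono) auto
  \<comment> \<open>The squares of \<open>infdist x X\<close> cancel, leaving a linear
    comparison.\<close>
  with r2 have "\<tau> * infdist x X < \<tau> * \<tau>" by (simp add: power2_eq_square algebra_simps)
  then show "infdist x X < \<tau>" using \<open>0 < \<tau>\<close> by simp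
qed

context
  fixes x p q :: 'a and r t :: real
  assumes \<tau>: "0 < \<tau>" and r: "r \<le> sqrt (\<tau>\<^sup>2 + (\<tau> - infdist x X)\<^sup>2)"
    and p: "p \<in> X" "dist x p < r" and q: "q \<in> X" "dist x q < r"
    and t: "0 \<le> t" "t \<le> 1"
begin

lemma norm_segment_to_center:
  "(norm ((1 - t) *\<^sub>R p + t *\<^sub>R q - x))\<^sup>2 < r\<^sup>2 - t * (1 - t) * (norm (p - q))\<^sup>2"
proof -
  have "(norm (p - x))\<^sup>2 < r\<^sup>2" "(norm (q - x))\<^sup>2 < r\<^sup>2"
    using p(2) q(2) by (auto intro!: power_strict_mono simp: dist_norm norm_minus_commute)
  then have "(1 - t) * (norm (p - x))\<^sup>2 + t * (norm (q - x))\<^sup>2 < r\<^sup>2"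
    using t by (intro convex_bound_lt) auto
  then show ?thesis by (simp add: norm_convex_combination_power2)
qed

text \<open>If \<open>z\<close> were at distance at least \<open>\<tau>\<close> from
  \<open>X\<close>, so would \<open>p\<close> and \<open>q\<close> be from \<open>z\<close>, and
  Stewart's theorem makes the gain at least \<open>\<tau>\<^sup>2\<close>. Then \<open>z\<close> is
  so close to \<open>x\<close> that the triangle inequality puts it within \<open>\<tau>\<close> of
  \<open>X\<close>.\<close>

lemma infdist_segment_less: "infdist ((1 - t) *\<^sub>R p + t *\<^sub>R q) X < \<tau>"
proof (rule ccontr)
  define z where "z = (1 - t) *\<^sub>R p + t *\<^sub>R q"
  assume "\<not> infdist ((1 - t) *\<^sub>R p + t *\<^sub>R q) X < \<tau>"
  then have far: "\<tau> \<le> infdist z X" by (simp add: z_def)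
  note x = infdist_less_of_mem_ball[OF \<tau> r p]
  have "\<tau>\<^sup>2 \<le> (norm (v - z))\<^sup>2" if "v \<in> X" for v
    using far infdist_le[OF that, of z] \<tau>
    by (intro power_mono) (auto simp: dist_norm norm_minus_commute)
  with p(1) q(1) t have "(1 - t) * \<tau>\<^sup>2 + t * \<tau>\<^sup>2 \<le> (1 - t) * (norm (p - z))\<^sup>2 + t * (norm (q - z))\<^sup>2"
    by (intro add_mono mult_left_mono) auto
  then have "\<tau>\<^sup>2 \<le> t * (1 - t) * (norm (p - q))\<^sup>2"
    using norm_convex_combination_power2[of t p q z] by (simp add: z_def algebra_simps)
  then have "(norm (z - x))\<^sup>2 < (\<tau> - infdist x X)\<^sup>2"
    using norm_segment_to_center x(2) by (simp add: z_def)
  then have "norm (z - x) < \<tau> - infdist x X"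
    by (rule power_less_imp_less_base) (use x(1) in simp)
  then show False using far infdist_triangle[of z X x] by (simp add: dist_norm)
qed

text \<open>The law of cosines expresses \<open>norm (x - m)\<close> through
  \<open>norm (z - x)\<close> and an inner product. The bounds \<open>zx\<close> and
  \<open>angle\<close> on these add up to exactly \<open>r\<^sup>2\<close>.\<close>

lemma proj_segment_in_ball: "dist x (proj ((1 - t) *\<^sub>R p + t *\<^sub>R q)) < r"
proof -
  define z where "z = (1 - t) *\<^sub>R p + t *\<^sub>R q"
  define m where "m = proj z"
  define s where "s = norm (z - m)"
  define d where "d = infdist x X"
  have z: "infdist z X < \<tau>" using infdist_segment_less by (simp add: z_def)
  have s: "0 \<le> s" "s < \<tau>" using z by (auto simp: s_def m_def infdist_eq dist_norm)
  have x: "d < \<tau>" "r\<^sup>2 \<le> \<tau>\<^sup>2 + (\<tau> - d)\<^sup>2"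
    using infdist_less_of_mem_ball[OF \<tau> r p] by (auto simp: d_def)
  have r0: "0 \<le> r" using p(2) zero_le_dist[of x p] by linarith
  have zx: "(norm (z - x))\<^sup>2 < r\<^sup>2 - 2 * \<tau> * s + s\<^sup>2"
  proof (cases "s = 0")
    case True
    have "0 \<le> t * (1 - t) * (norm (p - q))\<^sup>2" using t by simp
    then show ?thesis using norm_segment_to_center True by (simp add: z_def)
  next
    case False
    have fed: "2 * \<tau> * ((v - m) \<bullet> (z - m)) \<le> s * (norm (v - m))\<^sup>2" if "v \<in> X" for v
      using federer_inequality[OF z that] by (simp add: m_def s_def)
    \<comment> \<open>Federer's inequality at \<open>p\<close> and \<open>q\<close> is averaged with
      weights \<open>1 - t\<close> and \<open>t\<close>; the weighted sum of \<open>p - m\<close>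
      and \<open>q - m\<close> is \<open>z - m\<close>.\<close>
    have "2 * \<tau> * s\<^sup>2 = 2 * \<tau> * (((1 - t) *\<^sub>R (p - m) + t *\<^sub>R (q - m)) \<bullet> (z - m))"
      unfolding s_def power2_norm_eq_inner by (simp add: z_def algebra_simps)
    also have "\<dots> = (1 - t) * (2 * \<tau> * ((p - m) \<bullet> (z - m))) + t * (2 * \<tau> * ((q - m) \<bullet> (z - m)))"
      by (simp only: inner_add_left inner_scaleR_left) (simp add: algebra_simps)
    also have "\<dots> \<le> (1 - t) * (s * (norm (p - m))\<^sup>2) + t * (s * (norm (q - m))\<^sup>2)"
      using fed p(1) q(1) t by (intro add_mono mult_left_mono) auto
    also have "\<dots> = s * (s\<^sup>2 + t * (1 - t) * (norm (p - q))\<^sup>2)"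
    proof -
      have "s\<^sup>2 = (1 - t) * (norm (p - m))\<^sup>2 + t * (norm (q - m))\<^sup>2 - t * (1 - t) * (norm (p - q))\<^sup>2"
        unfolding s_def z_def by (rule norm_convex_combination_power2)
      then show ?thesis by (simp only:) (simp add: algebra_simps)
    qed
    finally have "s * (2 * \<tau> * s) \<le> s * (s\<^sup>2 + t * (1 - t) * (norm (p - q))\<^sup>2)"
      by (simp add: power2_eq_square algebra_simps)
    then have "2 * \<tau> * s \<le> s\<^sup>2 + t * (1 - t) * (norm (p - q))\<^sup>2"
      using False s by simp
    then show ?thesis using norm_segment_to_center by (simp add: z_def)
  qed
  \<comment> \<open>Otherwise \<open>x\<close> lies beyond the centre \<open>c\<close> of the tangent ball, hence too far from \<open>z\<close>.\<close>
  have angle: "(x - m) \<bullet> (z - m) \<le> \<tau> * s"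
  proof (rule ccontr)
    assume neg: "\<not> (x - m) \<bullet> (z - m) \<le> \<tau> * s"
    then have s0: "0 < s" using s unfolding s_def by (cases "z = m") auto
    define c where "c = m + (\<tau> / s) *\<^sub>R (z - m)"
    define y where "y = proj x"
    \<comment> \<open>Since \<open>y\<close> lies in \<open>X\<close>, it is outside the tangent
      ball around \<open>c\<close>; being at distance \<open>d\<close> from \<open>y\<close>, the
      point \<open>x\<close> is at least \<open>\<tau> - d\<close> away from
      \<open>c\<close>.\<close>
    have "2 * \<tau> * ((y - m) \<bullet> (z - m)) \<le> s * (norm (y - m))\<^sup>2"
      using federer_inequality[OF z proj_in] by (simp add: m_def s_def y_def)
    then have "\<tau>\<^sup>2 \<le> (norm (y - m))\<^sup>2 - 2 * (\<tau> / s) * ((y - m) \<bullet> (z - m)) + (\<tau> / s)\<^sup>2 * s\<^sup>2"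
      using s0 by (simp add: field_simps)
    also have "\<dots> = (norm (y - m - (\<tau> / s) *\<^sub>R (z - m)))\<^sup>2"
      unfolding s_def by (rule norm_diff_scaleR_power2[symmetric])
    also have "y - m - (\<tau> / s) *\<^sub>R (z - m) = y - c" by (simp add: c_def)
    finally have "\<tau> \<le> dist y c" unfolding dist_norm by (rule power2_le_imp_le) simp
    moreover have "dist x y = d" by (simp add: d_def y_def infdist_eq)
    ultimately have "\<tau> - d \<le> norm (x - c)"
      using dist_triangle[of y c x] by (simp add: dist_norm norm_minus_commute)
    then have "(\<tau> - d)\<^sup>2 \<le> (norm (x - c))\<^sup>2" using x(1) by (intro power_mono) auto
    moreover have "(norm (z - x))\<^sup>2 = (norm (x - c))\<^sup>2
        + 2 * ((\<tau> - s) / s) * ((x - c) \<bullet> (z - m)) + (\<tau> - s)\<^sup>2"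
    proof -
      have "x - z = (x - c) + ((\<tau> - s) / s) *\<^sub>R (z - m)"
        using s0 by (simp add: c_def diff_divide_distrib algebra_simps)
      then have "(norm (z - x))\<^sup>2 = (norm ((x - c) + ((\<tau> - s) / s) *\<^sub>R (z - m)))\<^sup>2"
        by (metis norm_minus_commute)
      also have "\<dots> = (norm (x - c))\<^sup>2 + 2 * ((\<tau> - s) / s) * ((x - c) \<bullet> (z - m))
          + ((\<tau> - s) / s)\<^sup>2 * s\<^sup>2"
        using norm_diff_scaleR_power2[of "x - c" "- ((\<tau> - s) / s)" "z - m"]
        unfolding s_def[symmetric] by simp
      finally show ?thesis using s0 by (simp add: power_divide)
    qed
    moreover have "0 \<le> 2 * ((\<tau> - s) / s) * ((x - c) \<bullet> (z - m))"
    proof -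
      have "(x - c) \<bullet> (z - m) = (x - m) \<bullet> (z - m) - (\<tau> / s) * s\<^sup>2"
        unfolding s_def power2_norm_eq_inner c_def by (simp add: inner_diff_left inner_add_left)
      also have "\<dots> = (x - m) \<bullet> (z - m) - \<tau> * s" using s0 by (simp add: power2_eq_square)
      finally show ?thesis using neg s s0 by simp
    qed
    \<comment> \<open>This contradicts \<open>zx\<close>: the admissible radius gives precisely
      \<open>(\<tau> - d)\<^sup>2 + (\<tau> - s)\<^sup>2\<close> as a strict upper bound.\<close>
    ultimately have "(\<tau> - d)\<^sup>2 + (\<tau> - s)\<^sup>2 \<le> (norm (z - x))\<^sup>2" by linarith
    then show False using zx x(2) by (simp add: power2_eq_square algebra_simps)
  qed
  have "(norm (x - m))\<^sup>2 = (norm (z - x))\<^sup>2 + 2 * ((x - m) \<bullet> (z - m)) - s\<^sup>2"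
    unfolding s_def power2_norm_eq_inner
    by (simp add: inner_diff_left inner_diff_right inner_commute algebra_simps)
  also have "\<dots> < r\<^sup>2" using zx angle by simp
  finally have "norm (x - m) < r" using r0 by (rule power_less_imp_less_base)
  then show ?thesis by (simp add: dist_norm m_def z_def)
qed

end

section \<open>The contraction of the intersection\<close>

theorem contractible_Inter_restricted_balls:
  assumes "0 < \<tau>" "I \<noteq> {}" "\<And>x. x \<in> I \<Longrightarrow> r x \<le> sqrt (\<tau>\<^sup>2 + (\<tau> - infdist x X)\<^sup>2)"
  shows "contractible (\<Inter>x\<in>I. restricted_ball X x (r x))"
proof -
  define A where "A = (\<Inter>x\<in>I. restricted_ball X x (r x))"
  have "contractible A"
  proof (cases "A = {}")
    case False
    then obtain p where p: "p \<in> A" by blast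
    define g where "g = (\<lambda>(t, q). (1 - t) *\<^sub>R q + t *\<^sub>R p :: 'a)"
    \<comment> \<open>A single ball already keeps the segments within \<open>\<tau>\<close> of
      \<open>X\<close>; all of them are used only for the projected points.\<close>
    obtain x0 where x0: "x0 \<in> I" using assms(2) by blast
    have mem: "q \<in> X \<and> dist x q < r x" if "q \<in> A" "x \<in> I" for q x
      using that by (auto simp: A_def restricted_ball_def)
    have near: "infdist (g (t, q)) X < \<tau>" if "t \<in> {0..1}" "q \<in> A" for t q
      using infdist_segment_less[OF assms(1) assms(3)[OF x0], of q p t]
        mem[OF p x0] mem[OF that(2) x0] that(1) by (simp add: g_def)
    have "proj (g (t, q)) \<in> A" if "t \<in> {0..1}" "q \<in> A" for t q
      unfolding A_def
    proof
      fix x assume x: "x \<in> I"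
      show "proj (g (t, q)) \<in> restricted_ball X x (r x)"
        using proj_segment_in_ball[OF assms(1) assms(3)[OF x], of q p t]
          mem[OF p x] mem[OF that(2) x] that(1) proj_in by (simp add: g_def restricted_ball_def)
    qed
    moreover have "continuous_on ({0..1} \<times> A) (proj \<circ> g)"
    proof (rule continuous_on_compose)
      show "continuous_on ({0..1} \<times> A) g"
        unfolding g_def case_prod_unfold by (intro continuous_intros)
      show "continuous_on (g ` ({0..1} \<times> A)) proj"
        using near by (intro continuous_on_subset[OF continuous_on_proj]) auto
    qed
    \<comment> \<open>The endpoints of each segment lie in \<open>X\<close>, so \<open>proj\<close>
      fixes them.\<close>
    moreover have "proj (g (0, q)) = q \<and> proj (g (1, q)) = p" if "q \<in> A" for q
      using mem[OF p x0] mem[OF that x0] by (simp add: g_def closest_point_self)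
    ultimately have "homotopic_with_canon (\<lambda>x. True) A A id (\<lambda>x. p)"
      by (subst homotopic_with) (auto intro!: exI[of _ "proj \<circ> g"])
    then show ?thesis unfolding contractible_def by blast
  qed simp
  then show ?thesis by (simp add: A_def)
qed

end

theorem theorem9:
  fixes X P :: "(real ^ 'd) set"
    and r :: "real ^ 'd \<Rightarrow> real"
    and \<tau> :: real
  assumes "X \<noteq> {}" and "closed X"
    and "reach X = ereal \<tau>" and "0 < \<tau>"
    and "\<forall>x\<in>P. 0 < r x"
    and "\<forall>x\<in>P. r x \<le> sqrt (\<tau>\<^sup>2 + (\<tau> - infdist x X)\<^sup>2)"
  shows "\<forall>I. I \<subseteq> P \<and> I \<noteq> {} \<and> (\<Inter>x\<in>I. restricted_ball X x (r x)) \<noteq> {} \<longrightarrow>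
           contractible (\<Inter>x\<in>I. restricted_ball X x (r x))"
proof -
  interpret reach_at_least X \<tau>
    using assms by unfold_locales auto
  show ?thesis
    using assms(4,6) by (auto intro!: contractible_Inter_restricted_balls)
qed

end
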